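(* Let $N\ge 1$, let $T:\mathbb{R}_+^N\to\mathbb{R}_{++}^N$ be a continuous concave mapping with lower bounding matrix $M\in\mathbb{R}_+^{N\times N}$, let $\rho(M)$ denote the spectral radius of $M$, and let $\|\cdot\|_a$ be a monotone norm on $\mathbb{R}^N$. Let $U:\mathbb{R}_{++}\to\mathbb{R}_{++}$ be the utility function associated with the canonical utility maximization problem for $T$ and $\|\cdot\|_a$. Then each of the following holds: (i) (Upper bound) For every $\bar p\in\mathbb{R}_{++}$, $U(\bar p)\le \dfrac{\bar p}{\|T(0)\|_a}$. Furthermore, if $\rho(M)>0$, then for every $\bar p\in\mathbb{R}_{++}$ we also have $U(\bar p)<\dfrac{1}{\rho(M)}$. (ii) (Combined upper bound) Assume that $\rho(M)>0$ and let $u:=\|T(0)\|_a/\rho(M)$. Then for every $\bar p\in\mathbb{R}_{++}$, $$U(\bar p)\le\begin{cases}\dfrac{1}{\rho(M)} & \text{if }\bar p\ge u,\\[2mm] \dfrac{\bar p}{\|T(0)\|_a} & \text{otherwise.}\end{cases}$$ (iii) (Lower bound) Let $\beta\in\mathbb{R}_{++}$ be an arbitrary scalar satisfying $\|p\|_\infty\le\beta\|p\|_a$ for every $p\in\mathbb{R}_{++}^N$. Then for every $\bar p\in\mathbb{R}_{++}$, $$U(\bar p)\ge\frac{\bar p}{\|T(\bar p\beta\mathbf{1})\|_a}.$$ (iv) (Asymptotic lower bound) Write $T(p)=[t^{(1)}(p),\ldots,t^{(N)}(p)]^t$ with $t^{(i)}:\mathbb{R}_+^N\to\mathbb{R}_{++}$,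 let $\beta$ be as in (iii), and define $p_\infty:=[t^{(1)}_\infty(\mathbf{1}),\ldots,t^{(N)}_\infty(\mathbf{1})]$, where $t^{(i)}_\infty$ is the asymptotic function of $t^{(i)}$. Then $$c_\infty:=\lim_{\bar p\to\infty}U(\bar p)\ \ge\ \begin{cases}\dfrac{1}{\beta\|p_\infty\|_a} & \text{if }\|p_\infty\|_a>0,\\[2mm] \infty & \text{otherwise.}\end{cases}$$
   Context: Notation: $\mathbb{R}_+=[0,\infty)$, $\mathbb{R}_{++}=(0,\infty)$; vector inequalities are entrywise; $\mathbf{1}\in\mathbb{R}^N$ is the all-ones vector and $e_j$ the $j$th standard basis vector. A mapping $T:\mathbb{R}_+^N\to\mathbb{R}^N$ is concave if $T(\alpha x+(1-\alpha)y)\ge \alpha T(x)+(1-\alpha)T(y)$ for all $x,y\in\mathbb{R}_+^N$, $\alpha\in(0,1)$. A norm $\|\cdot\|$ on $\mathbb{R}^N$ is monotone if for all $x,y\in\mathbb{R}_+^N$, $x\ge y$ implies $\|x\|\ge\|y\|$. Canonical utility maximization problem: given a power budget $\bar p\in\mathbb{R}_{++}$, maximize $c$ over $(p,c)\in\mathbb{R}_+^N\times\mathbb{R}_{++}$ subject to $p=cT(p)$ and $\|p\|_a\le\bar p$. It is known that for every $\bar p>0$ this problem has a unique solution $(p^\star_{\bar p},c^\star_{\bar p})\in\mathbb{R}_{++}^N\times\mathbb{R}_{++}$, and that it is also the unique pair satisfying $T(p)=\frac1c p$ and $\|p\|_a=\bar p$. The utility function is $U:\mathbb{R}_{++}\to\mathbb{R}_{++}$,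 $U(\bar p)=c^\star_{\bar p}$; it is known to be (strictly) increasing, so its limit as $\bar p\to\infty$ exists in $(0,\infty]$. Lower bounding matrix: for a continuous concave $T=[t_1,\ldots,t_N]:\mathbb{R}_+^N\to\mathbb{R}_{++}^N$, it is the matrix $M\in\mathbb{R}_+^{N\times N}$ with entries $[M]_{i,j}=\lim_{h\to0^+}h\,t_i(h^{-1}e_j)$ (the limits exist and are finite and non-negative). Asymptotic (recession) function: for a continuous concave $f:\mathbb{R}_+^N\to\mathbb{R}_{++}$ (extended by $-\infty$ outside $\mathbb{R}_+^N$), $f_\infty(y)=\lim_{h\to\infty}\frac{f(x+hy)-f(x)}{h}$ (independent of $x\in\mathbb{R}_+^N$), and equivalently $f_\infty(y)=\lim_{h\to0^+}h f(h^{-1}y)$. *)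

theory Defs
  imports "HOL-Analysis.Analysis" "HOL-Library.Extended_Real"
begin

text \<open>
  Mappings on the nonnegative orthant are total functions on \<open>real ^ 'n\<close> whose values outside
  the orthant \<open>{0..}\<close> are irrelevant. The library order \<open>\<le>\<close> on \<open>real ^ 'n\<close> is the entrywise one,
  but its strict part \<open><\<close> is not the entrywise strict order; hence \<open>pos_orthant\<close>.
\<close>

definition pos_orthant :: "(real ^ 'n) set" where
  "pos_orthant = {x. \<forall>i. 0 < x $ i}"

definition concave_mapping :: "(real ^ 'n \<Rightarrow> real ^ 'n) \<Rightarrow> bool" where
  "concave_mapping T \<longleftrightarrow>
     (\<forall>x\<in>{0..}. \<forall>y\<in>{0..}. \<forall>\<alpha>\<in>{0<..<1}.
        \<alpha> *\<^sub>R T x + (1 - \<alpha>) *\<^sub>R T y \<le> T (\<alpha> *\<^sub>R x + (1 - \<alpha>) *\<^sub>R y))"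

definition is_norm :: "('a::real_vector \<Rightarrow> real) \<Rightarrow> bool" where
  "is_norm \<nu> \<longleftrightarrow>
     (\<forall>x. 0 \<le> \<nu> x) \<and> (\<forall>x. \<nu> x = 0 \<longleftrightarrow> x = 0) \<and>
     (\<forall>a x. \<nu> (a *\<^sub>R x) = \<bar>a\<bar> * \<nu> x) \<and> (\<forall>x y. \<nu> (x + y) \<le> \<nu> x + \<nu> y)"

definition monotone_norm :: "(real ^ 'n \<Rightarrow> real) \<Rightarrow> bool" where
  "monotone_norm \<nu> \<longleftrightarrow> is_norm \<nu> \<and> (\<forall>x\<in>{0..}. \<forall>y\<in>{0..}. y \<le> x \<longrightarrow> \<nu> y \<le> \<nu> x)"

definition feasible :: "(real ^ 'n \<Rightarrow> real ^ 'n) \<Rightarrow> (real ^ 'n \<Rightarrow> real) \<Rightarrow> real \<Rightarrow> (real ^ 'n) \<times> real \<Rightarrow> bool"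
  where "feasible T \<nu> pbar = (\<lambda>(p, c). 0 \<le> p \<and> 0 < c \<and> p = c *\<^sub>R T p \<and> \<nu> p \<le> pbar)"

definition is_solution ::
  "(real ^ 'n \<Rightarrow> real ^ 'n) \<Rightarrow> (real ^ 'n \<Rightarrow> real) \<Rightarrow> real \<Rightarrow> (real ^ 'n) \<times> real \<Rightarrow> bool"
  where "is_solution T \<nu> pbar = is_arg_max snd (feasible T \<nu> pbar)"

definition utility :: "(real ^ 'n \<Rightarrow> real ^ 'n) \<Rightarrow> (real ^ 'n \<Rightarrow> real) \<Rightarrow> real \<Rightarrow> real" where
  "utility T \<nu> pbar = snd (THE z. is_solution T \<nu> pbar z)"

definition lower_bounding_matrix :: "(real ^ 'n \<Rightarrow> real ^ 'n) \<Rightarrow> real ^ 'n ^ 'n" where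
  "lower_bounding_matrix T =
     (\<chi> i j. Lim (at_right 0) (\<lambda>h. h * T (inverse h *\<^sub>R axis j 1) $ i))"

text \<open>
  Eigenvalues are taken over the complex numbers: a nonnegative real matrix may have no real
  eigenvector for an eigenvalue other than the largest one. The definition is that of
  \<open>Jordan_Normal_Form.Spectral_Radius\<close>, restated for type-indexed matrices.
\<close>

definition spectral_radius :: "real ^ 'n ^ 'n \<Rightarrow> real" where
  "spectral_radius A =
     Max (norm ` {l :: complex. \<exists>v. v \<noteq> 0 \<and> (\<chi> i j. complex_of_real (A $ i $ j)) *v v = l *s v})"

text \<open>
  The limit defining the asymptotic function does not depend on the base point \<open>x\<close> of the
  difference quotient; the base point here is \<open>0\<close>. The value is meaningful only for directions
  in \<open>{0..}\<close>, where the half-line stays inside the domain.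
\<close>

definition asymptotic :: "(real ^ 'n \<Rightarrow> real) \<Rightarrow> real ^ 'n \<Rightarrow> real" where
  "asymptotic f y = Lim at_top (\<lambda>h. (f (0 + h *\<^sub>R y) - f 0) / h)"

definition asymptotic_at_one :: "(real ^ 'n \<Rightarrow> real ^ 'n) \<Rightarrow> real ^ 'n" where
  "asymptotic_at_one T = (\<chi> i. asymptotic (\<lambda>p. T p $ i) 1)"

end

theory Submission
  imports Defs "HOL-Computational_Algebra.Fundamental_Theorem_Algebra"
begin

text \<open>
  Brouwer's theorem applied to \<open>p \<mapsto> pbar *\<^sub>R T p /\<^sub>R \<nu> (T p)\<close> yields a pair with \<open>p = c *\<^sub>R T p\<close> and
  \<open>\<nu> p = pbar\<close>. A positive concave mapping is monotone and satisfies \<open>\<theta> T p > T (\<theta> p)\<close> for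
  \<open>\<theta> > 1\<close>, so comparing two fixed points at the coordinate with the largest ratio shows that this
  pair is the unique solution; hence \<open>U pbar = pbar / \<nu> (T p)\<close>, and monotonicity of \<open>T\<close> gives all
  bounds that do not involve the spectral radius. By concavity \<open>T p \<ge> T 0 + M p\<close>, so
  \<open>c M p < p\<close> entrywise; as \<open>p\<close> is positive, this forces every eigenvalue of \<open>M\<close> into the open disc
  of radius \<open>1 / c\<close>.
\<close>

subsection \<open>Eigenvalues of complex matrices\<close>

definition eigenvalues :: "complex ^ 'n ^ 'n \<Rightarrow> complex set" where
  "eigenvalues A = {l. \<exists>v. v \<noteq> 0 \<and> A *v v = l *s v}"

text \<open>The entries are those of \<open>A - X I\<close> over the polynomial ring. The usual
  monic polynomial differs by the sign \<open>(-1)^n\<close>, which changes neither roots nor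
  degree.\<close>

definition char_poly :: "complex ^ 'n ^ 'n \<Rightarrow> complex poly" where
  "char_poly A = det (\<chi> i j. if i = j then [:A $ i $ j, -1:] else [:A $ i $ j:])"

lemma poly_char_poly: "poly (char_poly A) l = det (A - mat l)"
  unfolding char_poly_def det_def poly_sum poly_mult poly_prod
  by (intro sum.cong refl arg_cong2[of _ _ _ _ "(*)"] prod.cong) (auto simp: mat_def)

lemma eigenvalues_eq_roots:
  fixes A :: "complex ^ 'n ^ 'n"
  shows "eigenvalues A = {l. poly (char_poly A) l = 0}"
proof -
  have "(\<exists>v. v \<noteq> 0 \<and> A *v v = l *s v) \<longleftrightarrow> det (A - mat l) = 0" for l
  proof -
    have "mat l *v v = l *s v" for v :: "complex ^ 'n"
      by (simp add: vec_eq_iff matrix_vector_mult_def mat_def if_distrib[of "\<lambda>a. a * _"] cong: if_cong)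
    then have "A *v v = l *s v \<longleftrightarrow> (A - mat l) *v v = 0" for v
      by (simp add: matrix_vector_mult_diff_rdistrib)
    then show ?thesis
      by (metis invertible_det_nz invertible_left_inverse matrix_left_invertible_ker)
  qed
  then show ?thesis
    by (simp add: eigenvalues_def poly_char_poly)
qed

text \<open>If the characteristic polynomial were a constant \<open>c\<close>, then \<open>det (u A - 1) = c u\<^sup>n\<close> for all
  \<open>u \<noteq> 0\<close>, which contradicts continuity at \<open>u = 0\<close>.\<close>

lemma degree_char_poly:
  fixes A :: "complex ^ 'n ^ 'n"
  shows "degree (char_poly A) \<noteq> 0"
proof
  assume "degree (char_poly A) = 0"
  then obtain c where c: "char_poly A = [:c:]"
    by (metis degree_eq_zeroE)
  have eq: "det ((\<chi> i. u *s A $ i) - mat 1) = u ^ CARD('n) * c" if "u \<noteq> 0" for u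
  proof -
    \<comment> \<open>Uses \<open>u A - I = u (A - I / u)\<close> and extracts the factor
      \<open>u\<close> from every row.\<close>
    have "det ((\<chi> i. u *s A $ i) - mat 1) = det (\<chi> i. u *s (A - mat (inverse u)) $ i)"
      using that by (intro arg_cong[of _ _ det]) (simp add: vec_eq_iff mat_def algebra_simps)
    also have "\<dots> = u ^ CARD('n) * det (A - mat (inverse u))"
      by (subst det_rows_mul) simp
    also have "det (A - mat (inverse u)) = c"
      by (simp add: c flip: poly_char_poly)
    finally show ?thesis .
  qed
  have "((\<lambda>u. det ((\<chi> i. u *s A $ i) - mat 1)) \<longlongrightarrow> det ((\<chi> i. 0 *s A $ i) - mat 1)) (at 0)"
    unfolding det_def vector_minus_component vec_lambda_beta vector_smult_component
    by (intro tendsto_intros)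
  moreover have "((\<lambda>u. det ((\<chi> i. u *s A $ i) - mat 1)) \<longlongrightarrow> 0 ^ CARD('n) * c) (at 0)"
    by (rule Lim_transform_eventually[of "\<lambda>u. u ^ CARD('n) * c"])
      (auto intro!: tendsto_intros simp: eventually_at_filter eq)
  ultimately have "det ((\<chi> i. 0 *s A $ i) - mat 1) = 0 ^ CARD('n) * c"
    by (rule tendsto_unique[rotated]) simp
  \<comment> \<open>The index type is nonempty, so the power of 0 vanishes. At \<open>u = 0\<close>
    the matrix is \<open>- I\<close>, whose determinant is \<open>(-1)^n\<close>, not 0.\<close>
  then have "det ((\<chi> i. 0 *s A $ i) - mat 1) = 0"
    by simp
  moreover have "det ((\<chi> i. 0 *s A $ i) - mat 1) = det (\<chi> i. (-1) *s (mat 1 :: complex ^ 'n ^ 'n) $ i)"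
    by (intro arg_cong[of _ _ det]) (simp add: vec_eq_iff)
  ultimately have "det (\<chi> i. (-1) *s (mat 1 :: complex ^ 'n ^ 'n) $ i) = 0"
    by metis
  then show False
    unfolding det_rows_mul by simp
qed

text \<open>Together with nonemptiness, finiteness makes the \<open>Max\<close> in
  \<open>spectral_radius\<close> a true maximum.\<close>

lemma finite_eigenvalues: "finite (eigenvalues A)"
  unfolding eigenvalues_eq_roots using degree_char_poly[of A]
  by (intro poly_roots_finite) auto

lemma eigenvalues_nonempty: "eigenvalues A \<noteq> {}"
  using fundamental_theorem_of_algebra[of "char_poly A"] degree_char_poly[of A]
  by (auto simp: eigenvalues_eq_roots constant_degree)

text \<open>One half of the Collatz--Wielandt characterization of the spectral radius.\<close>

lemma spectral_radius_less:
  fixes A :: "real ^ 'n ^ 'n"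
  assumes nonneg: "\<And>i j. 0 \<le> A $ i $ j" and x: "x \<in> pos_orthant"
    and less: "\<And>i. (A *v x) $ i < r * x $ i"
  shows "spectral_radius A < r"
proof -
  let ?A = "(\<chi> i j. complex_of_real (A $ i $ j)) :: complex ^ 'n ^ 'n"
  have x_pos: "0 < x $ i" for i
    using x by (simp add: pos_orthant_def)
  have "norm l < r" if "v \<noteq> 0" and v: "?A *v v = l *s v" for l v
  proof -
    \<comment> \<open>The weights \<open>x\<close> define a scaled maximum norm of \<open>v\<close>,
      attained at index \<open>k\<close>. Row \<open>k\<close> of the eigenvalue equation then
      bounds \<open>norm l\<close>.\<close>
    define q where "q = (\<lambda>i. norm (v $ i) / x $ i)"
    have "Max (range q) \<in> range q"
      by (intro Max_in) auto
    then obtain k where k: "q k = Max (range q)"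
      by (metis imageE)
    have le: "norm (v $ i) \<le> q k * x $ i" for i
    proof -
      have "q i \<le> q k"
        unfolding k by (rule Max_ge) auto
      then show ?thesis
        using x_pos[of i] by (simp add: q_def divide_le_eq)
    qed
    have "0 < q k"
    proof (rule ccontr)
      assume "\<not> 0 < q k"
      then have "q k * x $ i \<le> 0" for i
        using x_pos[of i] by (simp add: mult_nonpos_nonneg)
      then have "norm (v $ i) \<le> 0" for i
        by (rule order_trans[OF le])
      then have "v $ i = 0" for i
        by simp
      with \<open>v \<noteq> 0\<close> show False
        by (simp add: vec_eq_iff)
    qed
    have "norm l * (q k * x $ k) = norm ((?A *v v) $ k)"
      using x_pos[of k] unfolding v by (simp add: q_def norm_mult)
    also have "\<dots> \<le> (\<Sum>j\<in>UNIV. norm (?A $ k $ j * v $ j))"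
      unfolding matrix_vector_mult_def by (simp add: norm_sum)
    also have "\<dots> \<le> (\<Sum>j\<in>UNIV. q k * (A $ k $ j * x $ j))"
    proof (rule sum_mono)
      fix j
      show "norm (?A $ k $ j * v $ j) \<le> q k * (A $ k $ j * x $ j)"
        using mult_left_mono[OF le[of j] nonneg[of k j]] nonneg[of k j]
        by (simp add: norm_mult mult.left_commute)
    qed
    also have "\<dots> = q k * (A *v x) $ k"
      by (simp add: matrix_vector_mult_def sum_distrib_left)
    also have "\<dots> < q k * (r * x $ k)"
      using less \<open>0 < q k\<close> by simp
    finally have "norm l * (q k * x $ k) < r * (q k * x $ k)"
      by (simp add: mult.left_commute)
    then show ?thesis
      using \<open>0 < q k\<close> x_pos[of k] by (simp add: mult_less_cancel_right)
  qed
  then show ?thesis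
    using finite_eigenvalues[of ?A] eigenvalues_nonempty[of ?A]
    unfolding spectral_radius_def eigenvalues_def by (subst Max_less_iff) auto
qed

subsection \<open>Monotone norms\<close>

locale mono_norm =
  fixes \<nu> :: "real ^ 'n \<Rightarrow> real"
  assumes monotone: "monotone_norm \<nu>"
begin

lemma norm_nonneg: "0 \<le> \<nu> x"
  and norm_eq_0: "\<nu> x = 0 \<longleftrightarrow> x = 0"
  and norm_scale: "\<nu> (a *\<^sub>R x) = \<bar>a\<bar> * \<nu> x"
  and norm_triangle: "\<nu> (x + y) \<le> \<nu> x + \<nu> y"
  using monotone unfolding monotone_norm_def is_norm_def by blast+

lemma norm_mono: "0 \<le> y \<Longrightarrow> y \<le> x \<Longrightarrow> \<nu> y \<le> \<nu> x"
  using monotone unfolding monotone_norm_def by (meson atLeast_iff order_trans)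

lemma norm_pos: "x \<noteq> 0 \<Longrightarrow> 0 < \<nu> x"
  using norm_nonneg[of x] norm_eq_0[of x] by linarith

lemma convex_on_norm: "convex_on UNIV \<nu>"
proof (rule convex_onI)
  fix t :: real and x y assume "0 < t" "t < 1"
  then show "\<nu> ((1 - t) *\<^sub>R x + t *\<^sub>R y) \<le> (1 - t) * \<nu> x + t * \<nu> y"
    using norm_triangle[of "(1 - t) *\<^sub>R x" "t *\<^sub>R y"] by (simp add: norm_scale)
qed simp

text \<open>A finite convex function on an open set in finite dimension is continuous, so no
  comparison with the Euclidean norm is required.\<close>

lemma continuous_on_norm: "continuous_on UNIV \<nu>"
  by (intro convex_on_continuous convex_on_norm) simp

lemma norm_tendsto: "(f \<longlongrightarrow> l) F \<Longrightarrow> ((\<lambda>x. \<nu> (f x)) \<longlongrightarrow> \<nu> l) F"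
  using continuous_on_norm by (rule continuous_on_tendsto_compose) auto

text \<open>Entrywise, \<open>x\<close> dominates its single component
  \<open>x $ i *\<^sub>R axis i 1\<close>, so monotonicity of the norm applies. This bounds the ball
  in each coordinate.\<close>

lemma nth_le:
  assumes "0 \<le> x"
  shows "x $ i \<le> \<nu> x / \<nu> (axis i 1)"
proof -
  have "\<nu> (x $ i *\<^sub>R axis i 1) \<le> \<nu> x"
    using assms by (intro norm_mono) (auto simp: less_eq_vec_def axis_def)
  moreover have "0 < \<nu> (axis i 1)"
    by (rule norm_pos) (simp add: axis_eq_0_iff)
  ultimately show ?thesis
    using assms by (simp add: norm_scale less_eq_vec_def pos_le_divide_eq)
qed

text \<open>With convexity below, this provides the domain for Brouwer's theorem.\<close>

lemma compact_ball: "compact {x. 0 \<le> x \<and> \<nu> x \<le> r}"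
proof -
  have "{x. 0 \<le> x \<and> \<nu> x \<le> r} \<subseteq> cbox 0 (\<chi> i. r / \<nu> (axis i 1))"
    using nth_le order_trans[OF nth_le divide_right_mono[OF _ norm_nonneg]]
    by (auto simp: mem_box_cart less_eq_vec_def)
  then have "bounded {x. 0 \<le> x \<and> \<nu> x \<le> r}"
    using bounded_cbox bounded_subset by blast
  moreover have "closed ({0..} \<inter> {x. \<nu> x \<le> r})"
    by (intro closed_Int closed_Collect_le continuous_on_norm continuous_on_const)
      (simp add: atLeast_def less_eq_vec_def, intro closed_Collect_all closed_Collect_le continuous_intros)
  ultimately show ?thesis
    by (simp add: compact_eq_bounded_closed atLeast_def Collect_conj_eq)
qed

lemma convex_ball: "convex {x. 0 \<le> x \<and> \<nu> x \<le> r}"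
proof -
  have "convex {x. \<nu> x \<le> r}"
  proof (rule convexI)
    fix x y :: "real ^ 'n" and u v :: real
    assume *: "x \<in> {x. \<nu> x \<le> r}" "y \<in> {x. \<nu> x \<le> r}" and uv: "0 \<le> u" "0 \<le> v" "u + v = 1"
    have "\<nu> (u *\<^sub>R x + v *\<^sub>R y) \<le> u * \<nu> x + v * \<nu> y"
      using norm_triangle[of "u *\<^sub>R x" "v *\<^sub>R y"] uv by (simp add: norm_scale)
    also have "\<dots> \<le> r"
      using * uv by (intro convex_bound_le) auto
    finally show "u *\<^sub>R x + v *\<^sub>R y \<in> {x. \<nu> x \<le> r}"
      by simp
  qed
  moreover have "convex {x :: real ^ 'n. 0 \<le> x}"
    unfolding convex_def by (auto simp: less_eq_vec_def)
  ultimately show ?thesis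
    using convex_Int by (simp add: Collect_conj_eq)
qed

end

subsection \<open>Positive concave mappings\<close>

locale pos_concave =
  fixes T :: "real ^ 'n \<Rightarrow> real ^ 'n"
  assumes T_pos: "T ` {0..} \<subseteq> pos_orthant"
    and T_concave: "concave_mapping T"
begin

lemma T_nth_pos: "0 \<le> x \<Longrightarrow> 0 < T x $ i"
  using T_pos by (auto simp: pos_orthant_def)

lemma T_nonneg: "0 \<le> x \<Longrightarrow> 0 \<le> T x"
  using T_nth_pos by (simp add: less_eq_vec_def less_imp_le)

lemma T_neq_0: "0 \<le> x \<Longrightarrow> T x \<noteq> 0"
  using T_nth_pos by fastforce

lemma concave:
  assumes "0 \<le> x" "0 \<le> y" "0 < a" "a < 1"
  shows "a * T x $ i + (1 - a) * T y $ i \<le> T (a *\<^sub>R x + (1 - a) *\<^sub>R y) $ i"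
proof -
  have "a *\<^sub>R T x + (1 - a) *\<^sub>R T y \<le> T (a *\<^sub>R x + (1 - a) *\<^sub>R y)"
    using T_concave assms unfolding concave_mapping_def by simp
  then show ?thesis
    by (simp add: less_eq_vec_def)
qed

text \<open>The point \<open>y\<close> lies on the segment from \<open>x\<close> to the far point \<open>x + (y - x) / a\<close>, where \<open>T\<close> is
  still positive.\<close>

lemma T_mono:
  assumes "0 \<le> x" "x \<le> y"
  shows "T x \<le> T y"
proof -
  have *: "(1 - a) * T x $ i \<le> T y $ i" if "0 < a" "a < 1" for a i
  proof -
    define z where "z = x + inverse a *\<^sub>R (y - x)"
    have z: "0 \<le> z"
      using assms that by (simp add: z_def scaleR_nonneg_nonneg)
    have "a *\<^sub>R z + (1 - a) *\<^sub>R x = y"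
      using that by (simp add: z_def algebra_simps)
    then have "a * T z $ i + (1 - a) * T x $ i \<le> T y $ i"
      using concave[OF z assms(1) that] by metis
    then show ?thesis
      using mult_pos_pos[OF that(1) T_nth_pos[OF z, of i]] by linarith
  qed
  have "T x $ i \<le> T y $ i" for i
  proof (rule tendsto_upperbound)
    show "((\<lambda>a. (1 - a) * T x $ i) \<longlongrightarrow> T x $ i) (at_right 0)"
      by (auto intro!: tendsto_eq_intros)
    show "\<forall>\<^sub>F a in at_right 0. (1 - a) * T x $ i \<le> T y $ i"
      using * by (auto simp: eventually_at_right_field intro!: exI[of _ 1])
  qed simp
  then show ?thesis
    by (simp add: less_eq_vec_def)
qed

text \<open>\<open>x\<close> is the convex combination of \<open>\<theta> *\<^sub>R x\<close> and 0
  with weight \<open>1 / \<theta>\<close> on the former. Strictness comes from the positive entries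
  of \<open>T 0\<close>.\<close>

lemma T_scale_less:
  assumes "0 \<le> x" "1 < \<theta>"
  shows "T (\<theta> *\<^sub>R x) $ i < \<theta> * T x $ i"
proof -
  have "inverse \<theta> * T (\<theta> *\<^sub>R x) $ i + (1 - inverse \<theta>) * T 0 $ i \<le> T x $ i"
    using concave[of "\<theta> *\<^sub>R x" 0 "inverse \<theta>" i] assms
    by (simp add: inverse_less_1_iff scaleR_nonneg_nonneg)
  moreover have "0 < (1 - inverse \<theta>) * T 0 $ i"
    using assms T_nth_pos[of 0 i] by (simp add: inverse_less_1_iff)
  ultimately have "inverse \<theta> * T (\<theta> *\<^sub>R x) $ i < T x $ i"
    by linarith
  then show ?thesis
    using assms by (simp add: field_simps)
qed

section \<open>Recession functions and the lower bounding matrix\<close>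

text \<open>This is the asymptotic function of component \<open>i\<close>. By
  \<open>T_scale_less\<close> the quotient decreases in \<open>h\<close> for \<open>y\<close> in the
  orthant, so its limit at infinity can be written as an infimum, whose existence is
  immediate.\<close>

definition recession :: "real ^ 'n \<Rightarrow> 'n \<Rightarrow> real" where
  "recession y i = (INF h\<in>{0<..}. T (h *\<^sub>R y) $ i / h)"

lemma recession_bdd_below: "0 \<le> y \<Longrightarrow> bdd_below ((\<lambda>h. T (h *\<^sub>R y) $ i / h) ` {0<..})"
  by (rule bdd_belowI2[of _ 0]) (simp add: less_imp_le T_nth_pos scaleR_nonneg_nonneg)

lemma recession_nonneg: "0 \<le> y \<Longrightarrow> 0 \<le> recession y i"
  unfolding recession_def
  by (intro cINF_greatest) (auto simp: less_imp_le T_nth_pos scaleR_nonneg_nonneg)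

lemma recession_tendsto:
  assumes y: "0 \<le> y"
  shows "((\<lambda>h. T (h *\<^sub>R y) $ i / h) \<longlongrightarrow> recession y i) at_top"
proof (rule decreasing_tendsto)
  show "\<forall>\<^sub>F h in at_top. recession y i \<le> T (h *\<^sub>R y) $ i / h"
    using eventually_gt_at_top[of 0] unfolding recession_def
    by eventually_elim (auto intro!: cINF_lower recession_bdd_below y)
  fix r assume "recession y i < r"
  then obtain h where h: "0 < h" "T (h *\<^sub>R y) $ i / h < r"
    unfolding recession_def using recession_bdd_below[OF y] by (subst (asm) cINF_less_iff) auto
  show "\<forall>\<^sub>F k in at_top. T (k *\<^sub>R y) $ i / k < r"
    using eventually_gt_at_top[of h]
  proof eventually_elim
    case (elim k)
    have "T ((k / h) *\<^sub>R h *\<^sub>R y) $ i < k / h * T (h *\<^sub>R y) $ i"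
      using y h elim by (intro T_scale_less) (auto intro: scaleR_nonneg_nonneg)
    then have "T (k *\<^sub>R y) $ i / k < T (h *\<^sub>R y) $ i / h"
      using h elim by (simp add: field_simps)
    with h show ?case
      by simp
  qed
qed

text \<open>The difference quotient at base point 0 deviates from the quotient in
  \<open>recession\<close> by \<open>T 0 $ i / h\<close>, which vanishes.\<close>

lemma asymptotic_eq_recession:
  assumes y: "0 \<le> y"
  shows "asymptotic (\<lambda>p. T p $ i) y = recession y i"
proof -
  have "((\<lambda>h. T 0 $ i / h) \<longlongrightarrow> 0) at_top"
    by (intro tendsto_divide_0[OF tendsto_const] filterlim_at_top_imp_at_infinity filterlim_ident)
  with recession_tendsto[OF y]
  have "((\<lambda>h. T (h *\<^sub>R y) $ i / h - T 0 $ i / h) \<longlongrightarrow> recession y i - 0) at_top"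
    by (intro tendsto_diff)
  then show ?thesis
    unfolding asymptotic_def by (intro tendsto_Lim) (simp_all add: diff_divide_distrib)
qed

text \<open>The substitution of \<open>inverse h\<close> for \<open>h\<close> turns the right-hand
  limit at 0 into a limit at infinity.\<close>

lemma lower_bounding_matrix_eq_recession:
  "lower_bounding_matrix T $ i $ j = recession (axis j 1) i"
proof -
  have "0 \<le> (axis j 1 :: real ^ 'n)"
    by (simp add: less_eq_vec_def axis_def)
  from filterlim_compose[OF recession_tendsto[OF this] filterlim_inverse_at_top_right]
  show ?thesis
    unfolding lower_bounding_matrix_def by (simp, intro tendsto_Lim) (simp_all add: field_simps)
qed

text \<open>Concavity is applied to \<open>x\<close> and the far point
  \<open>(h * s) *\<^sub>R y\<close> with weight \<open>1 / h\<close> on the latter. The combination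
  is \<open>x + s *\<^sub>R y - x / h\<close>, which lies below \<open>x + s *\<^sub>R y\<close>, so
  \<open>T_mono\<close> applies; then \<open>h\<close> tends to infinity.\<close>

lemma add_recession_le:
  assumes "0 \<le> x" "0 \<le> y" "0 \<le> s"
  shows "T x $ i + s * recession y i \<le> T (x + s *\<^sub>R y) $ i"
proof (cases "s = 0")
  case False
  with assms have s: "0 < s" by simp
  \<comment> \<open>The subtracted 0 is the limit of \<open>inverse h * T x $ i\<close>.\<close>
  have "(T x $ i - 0) + s * recession y i \<le> T (x + s *\<^sub>R y) $ i"
  proof (rule tendsto_upperbound)
    have "((\<lambda>h. inverse h * T x $ i) \<longlongrightarrow> 0) at_top"
      by (intro tendsto_mult_left_zero tendsto_inverse_0_at_top filterlim_ident)
    moreover have "((\<lambda>h. T ((h * s) *\<^sub>R y) $ i / (h * s)) \<longlongrightarrow> recession y i) at_top"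
      using s by (intro filterlim_compose[OF recession_tendsto[OF assms(2)]]
          filterlim_at_top_mult_tendsto_pos[OF tendsto_const] filterlim_ident)
    ultimately show "((\<lambda>h. (T x $ i - inverse h * T x $ i) + s * (T ((h * s) *\<^sub>R y) $ i / (h * s)))
        \<longlongrightarrow> (T x $ i - 0) + s * recession y i) at_top"
      by (intro tendsto_add tendsto_diff tendsto_mult tendsto_const)
    show "\<forall>\<^sub>F h in at_top. (T x $ i - inverse h * T x $ i) + s * (T ((h * s) *\<^sub>R y) $ i / (h * s))
        \<le> T (x + s *\<^sub>R y) $ i"
      using eventually_gt_at_top[of 1]
    proof eventually_elim
      case (elim h)
      have "inverse h * T ((h * s) *\<^sub>R y) $ i + (1 - inverse h) * T x $ i
          \<le> T (inverse h *\<^sub>R (h * s) *\<^sub>R y + (1 - inverse h) *\<^sub>R x) $ i"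
        using assms elim
        by (intro concave) (auto simp: inverse_less_1_iff intro: scaleR_nonneg_nonneg)
      also have "\<dots> \<le> T (x + s *\<^sub>R y) $ i"
      proof -
        have "inverse h *\<^sub>R (h * s) *\<^sub>R y + (1 - inverse h) *\<^sub>R x = x + s *\<^sub>R y - inverse h *\<^sub>R x"
          using elim by (simp add: scaleR_diff_left)
        moreover have "0 \<le> inverse h *\<^sub>R x"
          using assms elim by (simp add: scaleR_nonneg_nonneg)
        ultimately have "inverse h *\<^sub>R (h * s) *\<^sub>R y + (1 - inverse h) *\<^sub>R x \<le> x + s *\<^sub>R y"
          by simp
        moreover have "0 \<le> inverse h *\<^sub>R (h * s) *\<^sub>R y + (1 - inverse h) *\<^sub>R x"
          using assms elim by (simp add: inverse_le_1_iff scaleR_nonneg_nonneg)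
        ultimately show ?thesis
          using T_mono by (simp add: less_eq_vec_def)
      qed
      finally show ?case
        using s elim by (simp add: field_simps)
    qed
  qed simp
  then show ?thesis
    by simp
qed simp

text \<open>Starting from 0, the vector \<open>x\<close> is assembled one coordinate at a time; each
  coordinate adds its share of a matrix column by \<open>add_recession_le\<close>.\<close>

lemma add_lower_bounding_matrix_le:
  assumes x: "0 \<le> x"
  shows "T 0 $ i + (lower_bounding_matrix T *v x) $ i \<le> T x $ i"
proof -
  have "T 0 $ i + (\<Sum>j\<in>F. x $ j * recession (axis j 1) i) \<le> T (\<Sum>j\<in>F. x $ j *\<^sub>R axis j 1) $ i"
    if "finite F" for F
    using that
  proof (induction F)
    case (insert k F)
    have "0 \<le> (\<Sum>j\<in>F. x $ j *\<^sub>R axis j 1 :: real ^ 'n)"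
      using x by (intro sum_nonneg) (simp add: less_eq_vec_def axis_def)
    then have "T (\<Sum>j\<in>F. x $ j *\<^sub>R axis j 1) $ i + x $ k * recession (axis k 1) i
        \<le> T ((\<Sum>j\<in>F. x $ j *\<^sub>R axis j 1) + x $ k *\<^sub>R axis k 1) $ i"
      using x by (intro add_recession_le) (auto simp: less_eq_vec_def axis_def)
    with insert show ?case
      by (simp add: add_ac)
  qed simp
  from this[of UNIV] show ?thesis
    using basis_expansion[of x]
    by (simp add: matrix_vector_mult_def lower_bounding_matrix_eq_recession mult.commute
        scalar_mult_eq_scaleR)
qed

end

subsection \<open>The utility maximization problem\<close>

locale utility_problem = pos_concave T + mono_norm \<nu>
  for T :: "real ^ 'n \<Rightarrow> real ^ 'n" and \<nu> :: "real ^ 'n \<Rightarrow> real" +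
  assumes T_cont: "continuous_on {0..} T"
begin

text \<open>Brouwer's theorem runs on the convex ball rather than the sphere. Since the normalized
  map takes only values of norm \<open>pbar\<close>, its fixed point still exhausts the
  budget.\<close>

lemma ex_fixed_point:
  assumes "0 < pbar"
  shows "\<exists>p. 0 \<le> p \<and> \<nu> p = pbar \<and> p = (pbar / \<nu> (T p)) *\<^sub>R T p"
proof -
  define S where "S = {x. 0 \<le> x \<and> \<nu> x \<le> pbar}"
  define f where "f = (\<lambda>p. (pbar / \<nu> (T p)) *\<^sub>R T p)"
  have T: "0 < \<nu> (T p)" if "0 \<le> p" for p
    using that by (intro norm_pos T_neq_0)
  have f: "0 \<le> f p" "\<nu> (f p) = pbar" if "0 \<le> p" for p
    using T[OF that] that assms T_nonneg by (auto simp: f_def norm_scale scaleR_nonneg_nonneg)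
  have "continuous_on {0..} f"
    unfolding f_def using T
    by (intro continuous_intros T_cont continuous_on_compose2[OF continuous_on_norm T_cont]) fastforce+
  then have "continuous_on S f"
    by (rule continuous_on_subset) (auto simp: S_def)
  moreover have "S \<noteq> {}"
    using norm_eq_0[of 0] assms by (auto simp: S_def intro!: exI[of _ 0])
  moreover have "f \<in> S \<rightarrow> S"
    using f by (auto simp: S_def)
  ultimately obtain p where "p \<in> S" "f p = p"
    using brouwer[of S f] compact_ball convex_ball by (auto simp: S_def)
  then show ?thesis
    using f[of p] by (auto simp: S_def f_def)
qed

text \<open>Let \<open>k\<close> maximize the ratio \<open>r k\<close> of \<open>q\<close> to
  \<open>p\<close>. If it exceeded 1, then \<open>q \<le> r k *\<^sub>R p\<close> and strict scaling
  of \<open>T\<close> would give \<open>q $ k < r k * p $ k = q $ k\<close>. With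
  \<open>c = d\<close>, both directions together yield uniqueness.\<close>

lemma fixed_points_le:
  assumes p: "0 \<le> p" "p = c *\<^sub>R T p" and q: "0 \<le> q" "q = d *\<^sub>R T q"
    and d: "0 < d" "d \<le> c"
  shows "q \<le> p"
proof -
  have p_pos: "0 < p $ i" for i
    using T_nth_pos[OF p(1), of i] d by (subst p(2)) simp
  define r where "r = (\<lambda>i. q $ i / p $ i)"
  have "Max (range r) \<in> range r"
    by (intro Max_in) auto
  then obtain k where k: "r k = Max (range r)"
    by (metis imageE)
  have le: "q $ i \<le> r k * p $ i" for i
  proof -
    have "r i \<le> r k"
      unfolding k by (rule Max_ge) auto
    then show ?thesis
      using p_pos[of i] by (simp add: r_def divide_le_eq)
  qed
  have "r k \<le> 1"
  proof (rule ccontr)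
    assume "\<not> r k \<le> 1"
    then have rk: "1 < r k" by simp
    have "q $ k = d * T q $ k"
      by (subst q(2)) simp
    also have "\<dots> \<le> d * T (r k *\<^sub>R p) $ k"
      using T_mono[OF q(1), of "r k *\<^sub>R p"] le d by (simp add: less_eq_vec_def)
    also have "\<dots> < d * (r k * T p $ k)"
      using T_scale_less[OF p(1) rk] d by simp
    also have "\<dots> \<le> c * (r k * T p $ k)"
      using d rk T_nth_pos[OF p(1), of k] by (intro mult_right_mono) auto
    also have "\<dots> = r k * (c *\<^sub>R T p) $ k"
      by simp
    also have "\<dots> = q $ k"
      using p_pos[of k] unfolding p(2)[symmetric] by (simp add: r_def)
    finally show False by simp
  qed
  then have "r k * p $ i \<le> p $ i" for i
    using p_pos[of i] by simp
  then show ?thesis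
    using le order_trans by (simp add: less_eq_vec_def) blast
qed

text \<open>If \<open>d < c\<close>, then \<open>q \<le> p\<close>, so
  \<open>q = d *\<^sub>R T q\<close> lies below \<open>(d / c) *\<^sub>R p\<close>, whose norm is
  strictly smaller than that of \<open>p\<close>. This serves both optimality and monotonicity of
  the utility.\<close>

lemma fixed_points_utility_le:
  assumes p: "0 \<le> p" "p = c *\<^sub>R T p" and q: "0 \<le> q" "q = d *\<^sub>R T q"
    and d: "0 < d" and le: "\<nu> p \<le> \<nu> q"
  shows "c \<le> d"
proof (rule ccontr)
  assume "\<not> c \<le> d"
  then have dc: "d < c" by simp
  have "q \<le> p"
    using fixed_points_le[OF p q] d dc by simp
  have "q = d *\<^sub>R T q"
    by (fact q)
  also have "\<dots> \<le> d *\<^sub>R T p"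
    using T_mono[OF q(1) \<open>q \<le> p\<close>] d by (simp add: scaleR_left_mono)
  also have "\<dots> = (d / c) *\<^sub>R (c *\<^sub>R T p)"
    using d dc by simp
  finally have "\<nu> q \<le> \<nu> ((d / c) *\<^sub>R p)"
    unfolding p(2)[symmetric] by (rule norm_mono[OF q(1)])
  also have "\<dots> = d / c * \<nu> p"
    using d dc by (simp add: norm_scale)
  also have "\<dots> < \<nu> p"
  proof -
    have "c *\<^sub>R T p \<noteq> 0"
      using T_neq_0[OF p(1)] d dc by simp
    then have "0 < \<nu> p"
      using norm_pos p(2) by metis
    then show ?thesis
      using d dc by (simp add: field_simps)
  qed
  finally show False
    using le by simp
qed

text \<open>A fixed point is optimal for the budget equal to its own norm:
  \<open>fixed_points_utility_le\<close> bounds every feasible utility, and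
  \<open>fixed_points_le\<close> in both directions excludes a second maximizer. This evaluates the
  \<open>THE\<close> in \<open>utility\<close>.\<close>

lemma is_solution_iff:
  assumes q: "0 \<le> q" "q = d *\<^sub>R T q" and d: "0 < d"
  shows "is_solution T \<nu> (\<nu> q) z \<longleftrightarrow> z = (q, d)"
proof -
  have q_feasible: "feasible T \<nu> (\<nu> q) (q, d)"
    using q d by (simp add: feasible_def)
  have max: "c \<le> d" if "feasible T \<nu> (\<nu> q) (p, c)" for p c
    using that fixed_points_utility_le[of p c q d] q d by (simp add: feasible_def)
  have uniq: "p = q" if "feasible T \<nu> (\<nu> q) (p, d)" for p
    using that fixed_points_le[of p d q d] fixed_points_le[of q d p d] q d
    by (simp add: feasible_def)
  show ?thesis
  proof
    assume z: "is_solution T \<nu> (\<nu> q) z"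
    obtain p c where "z = (p, c)"
      by (cases z)
    with z have pc: "feasible T \<nu> (\<nu> q) (p, c)" and "\<not> c < d"
      using q_feasible unfolding is_solution_def is_arg_max_def by auto
    with max[OF pc] have "c = d"
      by simp
    with pc uniq show "z = (q, d)"
      unfolding \<open>z = (p, c)\<close> by blast
  next
    assume "z = (q, d)"
    with q_feasible max show "is_solution T \<nu> (\<nu> q) z"
      unfolding is_solution_def is_arg_max_def by (auto simp: not_less)
  qed
qed

lemma ex_utility_fixed_point:
  assumes "0 < pbar"
  shows "\<exists>p. 0 \<le> p \<and> \<nu> p = pbar \<and> p = utility T \<nu> pbar *\<^sub>R T p \<and>
    utility T \<nu> pbar = pbar / \<nu> (T p)"
proof -
  obtain p where p: "0 \<le> p" "\<nu> p = pbar" "p = (pbar / \<nu> (T p)) *\<^sub>R T p"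
    using ex_fixed_point[OF assms] by blast
  have "0 < pbar / \<nu> (T p)"
    using assms norm_pos[OF T_neq_0[OF p(1)]] by simp
  then have "is_solution T \<nu> pbar z \<longleftrightarrow> z = (p, pbar / \<nu> (T p))" for z
    using is_solution_iff[OF p(1) p(3)] p(2) by simp
  then have "utility T \<nu> pbar = pbar / \<nu> (T p)"
    by (simp add: utility_def)
  with p show ?thesis
    by metis
qed

lemma utility_pos:
  assumes "0 < pbar"
  shows "0 < utility T \<nu> pbar"
proof -
  obtain p where "0 \<le> p" "utility T \<nu> pbar = pbar / \<nu> (T p)"
    using ex_utility_fixed_point[OF assms] by blast
  then show ?thesis
    using assms norm_pos[OF T_neq_0] by simp
qed

lemma utility_mono:
  assumes "0 < a" "a \<le> b"
  shows "utility T \<nu> a \<le> utility T \<nu> b"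
proof -
  obtain p where p: "0 \<le> p" "\<nu> p = a" "p = utility T \<nu> a *\<^sub>R T p"
    using ex_utility_fixed_point assms by blast
  obtain q where q: "0 \<le> q" "\<nu> q = b" "q = utility T \<nu> b *\<^sub>R T q"
    using ex_utility_fixed_point assms less_le_trans by blast
  show ?thesis
    using fixed_points_utility_le[OF p(1,3) q(1,3)] p(2) q(2) utility_pos assms by simp
qed

section \<open>Bounds on the utility at a fixed budget\<close>

lemma T_norm_mono: "0 \<le> x \<Longrightarrow> x \<le> y \<Longrightarrow> \<nu> (T x) \<le> \<nu> (T y)"
  by (intro norm_mono T_mono T_nonneg)

lemma utility_le:
  assumes "0 < pbar"
  shows "utility T \<nu> pbar \<le> pbar / \<nu> (T 0)"
proof -
  obtain p where "0 \<le> p" "utility T \<nu> pbar = pbar / \<nu> (T p)"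
    using ex_utility_fixed_point[OF assms] by blast
  then show ?thesis
    using assms norm_pos[OF T_neq_0[of 0]] T_norm_mono[of 0 p] by (simp add: frac_le)
qed

lemma utility_less_inverse_spectral_radius:
  assumes "0 < pbar" and \<rho>: "0 < spectral_radius (lower_bounding_matrix T)"
  shows "utility T \<nu> pbar < 1 / spectral_radius (lower_bounding_matrix T)"
proof -
  define c where "c = utility T \<nu> pbar"
  obtain p where p: "0 \<le> p" "p = c *\<^sub>R T p"
    using ex_utility_fixed_point[OF assms(1)] by (auto simp: c_def)
  have c: "0 < c"
    using utility_pos assms(1) by (simp add: c_def)
  have p_nth: "p $ i = c * T p $ i" for i
    by (subst p(2)) simp
  have "spectral_radius (lower_bounding_matrix T) < 1 / c"
  proof (rule spectral_radius_less)
    show "0 \<le> lower_bounding_matrix T $ i $ j" for i j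
      unfolding lower_bounding_matrix_eq_recession
      by (rule recession_nonneg) (simp add: less_eq_vec_def axis_def)
    show "p \<in> pos_orthant"
      unfolding pos_orthant_def using c T_nth_pos[OF p(1)] p_nth by simp
    \<comment> \<open>The entries of \<open>T 0\<close> are positive, which makes the inequality
      strict.\<close>
    show "(lower_bounding_matrix T *v p) $ i < 1 / c * p $ i" for i
      using add_lower_bounding_matrix_le[OF p(1), of i] T_nth_pos[of 0 i] c
      by (simp add: p_nth)
  qed
  then show ?thesis
    using \<rho> c by (simp add: c_def field_simps)
qed

text \<open>The choice of \<beta> puts the optimal \<open>p\<close> below the constant vector with
  entries \<open>pbar * \<beta>\<close>, so monotonicity enlarges the denominator in
  \<open>pbar / \<nu> (T p)\<close>.\<close>

lemma utility_ge:
  assumes "0 < pbar" and \<beta>: "\<forall>p\<in>pos_orthant. infnorm p \<le> \<beta> * \<nu> p"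
  shows "pbar / \<nu> (T ((pbar * \<beta>) *\<^sub>R 1)) \<le> utility T \<nu> pbar"
proof -
  obtain p where p: "0 \<le> p" "\<nu> p = pbar" "p = utility T \<nu> pbar *\<^sub>R T p"
      "utility T \<nu> pbar = pbar / \<nu> (T p)"
    using ex_utility_fixed_point[OF assms(1)] by blast
  have "p $ i = utility T \<nu> pbar * T p $ i" for i
    by (subst p(3)) simp
  then have "p \<in> pos_orthant"
    using utility_pos[OF assms(1)] T_nth_pos[OF p(1)] by (simp add: pos_orthant_def)
  with \<beta> have "infnorm p \<le> \<beta> * \<nu> p"
    by blast
  then have "infnorm p \<le> pbar * \<beta>"
    by (simp add: p(2) mult.commute)
  then have "p \<le> (pbar * \<beta>) *\<^sub>R 1"
    by (auto simp: less_eq_vec_def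
        intro: order_trans[OF abs_ge_self order_trans[OF component_le_infnorm_cart]])
  then show ?thesis
    using T_norm_mono[OF p(1)] norm_pos[OF T_neq_0[OF p(1)]] assms(1) by (simp add: p(4) frac_le)
qed

section \<open>Behaviour of the utility for large budgets\<close>

text \<open>This is the reciprocal of the lower bound in \<open>utility_ge\<close>. The factor
  \<beta> appears because the argument is scaled by \<open>r * \<beta>\<close> but the norm is
  divided by \<open>r\<close> alone.\<close>

lemma norm_T_ray_tendsto:
  assumes "0 < \<beta>"
  shows "((\<lambda>r. \<nu> (T ((r * \<beta>) *\<^sub>R 1)) / r) \<longlongrightarrow> \<beta> * \<nu> (asymptotic_at_one T)) at_top"
proof -
  have "((\<lambda>r. T ((r * \<beta>) *\<^sub>R 1) $ i / (r * \<beta>)) \<longlongrightarrow> asymptotic_at_one T $ i) at_top" for i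
    unfolding asymptotic_at_one_def vec_lambda_beta
    using assms by (subst asymptotic_eq_recession)
      (auto intro!: filterlim_compose[OF recession_tendsto]
          filterlim_at_top_mult_tendsto_pos[OF tendsto_const] filterlim_ident simp: less_eq_vec_def)
  then have "((\<lambda>r. inverse (r * \<beta>) *\<^sub>R T ((r * \<beta>) *\<^sub>R 1)) \<longlongrightarrow> asymptotic_at_one T) at_top"
    by (intro vec_tendstoI) (simp add: divide_inverse mult.commute)
  then have "((\<lambda>r. \<beta> * \<nu> (inverse (r * \<beta>) *\<^sub>R T ((r * \<beta>) *\<^sub>R 1))) \<longlongrightarrow>
      \<beta> * \<nu> (asymptotic_at_one T)) at_top"
    by (intro tendsto_mult_left norm_tendsto)
  moreover have "\<forall>\<^sub>F r in at_top. \<beta> * \<nu> (inverse (r * \<beta>) *\<^sub>R T ((r * \<beta>) *\<^sub>R 1)) =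
      \<nu> (T ((r * \<beta>) *\<^sub>R 1)) / r"
    using eventually_gt_at_top[of 0]
    by eventually_elim (use assms in \<open>simp add: norm_scale field_simps\<close>)
  ultimately show ?thesis
    by (rule Lim_transform_eventually)
qed

text \<open>A monotone function tends to its supremum; extended reals cover the unbounded
  case.\<close>

lemma utility_limit:
  "((\<lambda>pbar. ereal (utility T \<nu> pbar)) \<longlongrightarrow> (SUP r\<in>{0<..}. ereal (utility T \<nu> r))) at_top"
proof (rule increasing_tendsto)
  show "\<forall>\<^sub>F pbar in at_top. ereal (utility T \<nu> pbar) \<le> (SUP r\<in>{0<..}. ereal (utility T \<nu> r))"
    using eventually_gt_at_top[of 0] by eventually_elim (auto intro!: SUP_upper)
  fix x assume "x < (SUP r\<in>{0<..}. ereal (utility T \<nu> r))"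
  then obtain r where r: "0 < r" "x < ereal (utility T \<nu> r)"
    by (auto simp: less_SUP_iff)
  show "\<forall>\<^sub>F pbar in at_top. x < ereal (utility T \<nu> pbar)"
    using eventually_ge_at_top[of r]
  proof eventually_elim
    case (elim pbar)
    then have "ereal (utility T \<nu> r) \<le> ereal (utility T \<nu> pbar)"
      using utility_mono[OF r(1)] by simp
    with r(2) show ?case
      by (rule less_le_trans)
  qed
qed

lemma utility_limit_ge:
  assumes \<beta>: "0 < \<beta>" "\<forall>p\<in>pos_orthant. infnorm p \<le> \<beta> * \<nu> p"
  shows "(if \<nu> (asymptotic_at_one T) > 0 then ereal (1 / (\<beta> * \<nu> (asymptotic_at_one T))) else \<infinity>)
    \<le> (SUP r\<in>{0<..}. ereal (utility T \<nu> r))"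
proof (rule tendsto_le[OF _ utility_limit])
  let ?g = "\<lambda>r. \<nu> (T ((r * \<beta>) *\<^sub>R 1)) / r"
  have g_pos: "\<forall>\<^sub>F r in at_top. 0 < ?g r"
    using eventually_gt_at_top[of 0]
  proof eventually_elim
    case (elim r)
    then have "0 \<le> (r * \<beta>) *\<^sub>R (1 :: real ^ 'n)"
      using \<beta> by (simp add: less_eq_vec_def)
    then show ?case
      using elim norm_pos[OF T_neq_0] by simp
  qed
  show "((\<lambda>r. ereal (inverse (?g r))) \<longlongrightarrow> (if \<nu> (asymptotic_at_one T) > 0
      then ereal (1 / (\<beta> * \<nu> (asymptotic_at_one T))) else \<infinity>)) at_top"
  proof (cases "\<nu> (asymptotic_at_one T) > 0")
    case True
    then have "((\<lambda>r. inverse (?g r)) \<longlongrightarrow> inverse (\<beta> * \<nu> (asymptotic_at_one T))) at_top"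
      using \<beta> by (intro tendsto_inverse norm_T_ray_tendsto) auto
    with True show ?thesis
      by (simp add: inverse_eq_divide)
  next
    case False
    then have "\<nu> (asymptotic_at_one T) = 0"
      using norm_nonneg[of "asymptotic_at_one T"] by simp
    then have "(?g \<longlongrightarrow> 0) at_top"
      using norm_T_ray_tendsto[OF \<beta>(1)] by simp
    \<comment> \<open>Positivity of \<open>?g\<close> fixes the sign: its reciprocal tends to plus
      infinity.\<close>
    then have "filterlim (\<lambda>r. inverse (?g r)) at_top at_top"
      using g_pos by (rule filterlim_inverse_at_top)
    with False show ?thesis
      by (simp add: tendsto_PInfty_eq_at_top)
  qed
  show "\<forall>\<^sub>F r in at_top. ereal (inverse (?g r)) \<le> ereal (utility T \<nu> r)"
    using eventually_gt_at_top[of 0] by eventually_elim (use utility_ge[OF _ \<beta>(2)] in simp)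
qed simp

end

theorem proposition4:
  fixes T :: "real ^ 'n \<Rightarrow> real ^ 'n" and \<nu> :: "real ^ 'n \<Rightarrow> real"
  assumes T_pos: "T ` {0..} \<subseteq> pos_orthant"
    and T_cont: "continuous_on {0..} T"
    and T_concave: "concave_mapping T"
    and norm_mono: "monotone_norm \<nu>"
  shows
    "(\<forall>pbar>0. utility T \<nu> pbar \<le> pbar / \<nu> (T 0)) \<and>
     (spectral_radius (lower_bounding_matrix T) > 0 \<longrightarrow>
        (\<forall>pbar>0. utility T \<nu> pbar < 1 / spectral_radius (lower_bounding_matrix T))) \<and>
     (spectral_radius (lower_bounding_matrix T) > 0 \<longrightarrow>
        (\<forall>pbar>0. utility T \<nu> pbar \<le>
           (if pbar \<ge> \<nu> (T 0) / spectral_radius (lower_bounding_matrix T)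
            then 1 / spectral_radius (lower_bounding_matrix T)
            else pbar / \<nu> (T 0)))) \<and>
     (\<forall>\<beta>>0. (\<forall>p\<in>pos_orthant. infnorm p \<le> \<beta> * \<nu> p) \<longrightarrow>
        (\<forall>pbar>0. utility T \<nu> pbar \<ge> pbar / \<nu> (T ((pbar * \<beta>) *\<^sub>R 1)))) \<and>
     (\<forall>\<beta>>0. (\<forall>p\<in>pos_orthant. infnorm p \<le> \<beta> * \<nu> p) \<longrightarrow>
        (\<exists>c_inf :: ereal. ((\<lambda>pbar. ereal (utility T \<nu> pbar)) \<longlongrightarrow> c_inf) at_top \<and>
           c_inf \<ge> (if \<nu> (asymptotic_at_one T) > 0
                    then ereal (1 / (\<beta> * \<nu> (asymptotic_at_one T)))
                    else \<infinity>)))"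
proof -
  interpret utility_problem T \<nu>
    by unfold_locales (fact assms)+
  show ?thesis
    \<comment> \<open>The combined bound selects one of the two upper bounds in each case, with the
      spectral one weakened by \<open>less_imp_le\<close>.\<close>
    using utility_le utility_less_inverse_spectral_radius utility_ge utility_limit utility_limit_ge
    by (auto intro: less_imp_le)
qed

end
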